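(* Let $P=(X,\prec)$ be a poset with $|X|=n$, and let $z_1\prec z_2\prec z_3$ be distinct elements of $X$. Let $k,\ell\ge 1$ be integers and let $\mathrm{F}(k,\ell)$ be the number of linear extensions $L$ of $P$ with $L(z_2)-L(z_1)=k$ and $L(z_3)-L(z_2)=\ell$. Then $\mathrm{F}(k,\ell)>0$ if and only if $$b(z_1,z_2)-1\le k\le n+1-b(z_1)-b^*(z_2),$$ $$b(z_2,z_3)-1\le \ell\le n+1-b^*(z_3)-b(z_2),$$ $$b(z_1,z_3)-1\le k+\ell\le n+1-b^*(z_3)-b(z_1).$$
   Context: A linear extension of $P$ is a bijection $L:X\to\{1,\dots,n\}$ with $L(u)<L(v)$ whenever $u\prec v$. For $x\in X$, $b(x)=|\{y\in X: y\preccurlyeq x\}|$ and $b^*(x)=|\{y\in X: y\succcurlyeq x\}|$. For $x,y\in X$, $b(x,y)=|\{w\in X: x\preccurlyeq w\preccurlyeq y\}|$. *)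

theory Defs
  imports Main "HOL-Library.FuncSet"
begin

text \<open>
  A poset is given by a carrier \<open>X\<close> and its reflexive order \<open>r\<close> with \<^term>\<open>partial_order_on X r\<close>
  (which includes \<open>r \<subseteq> X \<times> X\<close>); \<open>(x, y) \<in> r\<close> reads \<open>x \<preceq> y\<close>.
\<close>

definition prec :: "'a rel \<Rightarrow> 'a \<Rightarrow> 'a \<Rightarrow> bool" where
  "prec r x y \<longleftrightarrow> (x, y) \<in> r \<and> x \<noteq> y"

text \<open>
  Taking \<open>L\<close> extensional on \<open>X\<close> (a fixed dummy value outside \<open>X\<close>) makes elements of this set
  correspond exactly to functions on \<open>X\<close>, so that the set is finite and can be counted.
\<close>

definition linear_extensions :: "'a set \<Rightarrow> 'a rel \<Rightarrow> ('a \<Rightarrow> nat) set" where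
  "linear_extensions X r =
     {L \<in> extensional X. bij_betw L X {1..card X} \<and>
        (\<forall>u\<in>X. \<forall>v\<in>X. prec r u v \<longrightarrow> L u < L v)}"

definition b_low :: "'a set \<Rightarrow> 'a rel \<Rightarrow> 'a \<Rightarrow> nat" where
  "b_low X r x = card {y \<in> X. (y, x) \<in> r}"

definition b_up :: "'a set \<Rightarrow> 'a rel \<Rightarrow> 'a \<Rightarrow> nat" where
  "b_up X r x = card {y \<in> X. (x, y) \<in> r}"

definition b_between :: "'a set \<Rightarrow> 'a rel \<Rightarrow> 'a \<Rightarrow> 'a \<Rightarrow> nat" where
  "b_between X r x y = card {w \<in> X. (x, w) \<in> r \<and> (w, y) \<in> r}"

definition F_count :: "'a set \<Rightarrow> 'a rel \<Rightarrow> 'a \<Rightarrow> 'a \<Rightarrow> 'a \<Rightarrow> int \<Rightarrow> int \<Rightarrow> nat" where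
  "F_count X r z1 z2 z3 k l =
     card {L \<in> linear_extensions X r.
             int (L z2) - int (L z1) = k \<and> int (L z3) - int (L z2) = l}"

end

theory Submission
  imports Defs
begin

text \<open>
  The bounds are exactly what is needed to choose positions \<open>s\<^sub>1 < s\<^sub>2 < s\<^sub>3\<close> with differences \<open>k\<close>
  and \<open>l\<close> such that the elements below some \<open>z\<^sub>i\<close>, above some \<open>z\<^sub>i\<close>, or between two of them
  all have enough room. Realising prescribed positions on a chain is a scheduling problem: each
  element is a unit job, released at the largest position prescribed weakly below it and due at the
  smallest position prescribed weakly above it. Hall's condition for time intervals reduces to
  these room conditions, and the earliest-deadline-first schedule, with ties broken by the order,
  is a linear extension.
\<close>

section \<open>Scheduling unit jobs with release times and deadlines\<close>

text \<open>
  A job may occupy the times from its release up to, but excluding, its deadline. Because of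
  truncated subtraction, the last assumption for \<open>b \<le> a\<close> says that no job has an empty time window.
\<close>

lemma schedule_exists:
  fixes release deadline :: "'a \<Rightarrow> nat"
  assumes "finite X" and wf: "wf R"
    and "\<And>u v. u \<in> X \<Longrightarrow> v \<in> X \<Longrightarrow> (u, v) \<in> R \<Longrightarrow> release u \<le> release v"
    and "\<And>u v. u \<in> X \<Longrightarrow> v \<in> X \<Longrightarrow> (u, v) \<in> R \<Longrightarrow> deadline u \<le> deadline v"
    and "\<And>a b. card {x \<in> X. a \<le> release x \<and> deadline x \<le> b} \<le> b - a"
  shows "\<exists>f. inj_on f X \<and> (\<forall>x\<in>X. release x \<le> f x \<and> f x < deadline x) \<and>
    (\<forall>u\<in>X. \<forall>v\<in>X. (u, v) \<in> R \<longrightarrow> f u < f v)"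
  using assms(1,3-)
proof (induction "card X" arbitrary: X release)
  case 0
  then show ?case by simp
next
  case (Suc c)
  note fin = Suc.prems(1) and rel_mono = Suc.prems(2) and dl_mono = Suc.prems(3)
    and hall = Suc.prems(4)
  have ne: "X \<noteq> {}" using Suc.hyps(2) by auto
  \<comment> \<open>Earliest deadline first: the job \<open>x\<close> to run at time
    \<open>m\<close> has the earliest deadline \<open>d\<close> among those released at
    \<open>m\<close>, and is \<open>R\<close>-minimal among the tied ones in
    \<open>U\<close>.\<close>
  define m where "m = Min (release ` X)"
  define T where "T = {x \<in> X. release x = m}"
  define d where "d = Min (deadline ` T)"
  define U where "U = {x \<in> T. deadline x = d}"
  have m_le: "m \<le> release y" if "y \<in> X" for y
    using that fin by (simp add: m_def)
  have "m \<in> release ` X" unfolding m_def using fin ne by (intro Min_in) auto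
  then have Tne: "T \<noteq> {}" by (auto simp: T_def)
  have finT: "finite T" using fin by (simp add: T_def)
  have d_le: "d \<le> deadline y" if "y \<in> T" for y
    using that finT by (simp add: d_def)
  have "d \<in> deadline ` T" unfolding d_def using finT Tne by (intro Min_in) auto
  then obtain x0 where "x0 \<in> U" by (auto simp: U_def)
  with wf obtain x where x: "x \<in> U" and x_min: "\<And>y. (y, x) \<in> R \<Longrightarrow> y \<notin> U"
    by (rule wfE_min) blast
  have xX: "x \<in> X" and rx: "release x = m" and dx: "deadline x = d"
    using x by (auto simp: U_def T_def)
  \<comment> \<open>By monotonicity, a predecessor of \<open>x\<close> would share its release and
    its deadline, hence lie in \<open>U\<close> against minimality.\<close>
  have x_first: "(y, x) \<notin> R" if "y \<in> X" for y
  proof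
    assume yx: "(y, x) \<in> R"
    have "release y = m" using rel_mono[OF that xX yx] m_le[OF that] rx by simp
    then have "y \<in> T" using that by (simp add: T_def)
    moreover from this have "deadline y = d"
      using dl_mono[OF that xX yx] d_le dx by (simp add: le_antisym)
    ultimately show False using x_min[OF yx] by (simp add: U_def)
  qed
  have mdx: "m < deadline x"
  proof (rule ccontr)
    assume "\<not> m < deadline x"
    then have "card {y \<in> X. m \<le> release y \<and> deadline y \<le> deadline x} = 0"
      using hall[of m "deadline x"] by simp
    moreover have "x \<in> {y \<in> X. m \<le> release y \<and> deadline y \<le> deadline x}"
      using xX rx by simp
    ultimately show False using fin by auto
  qed
  \<comment> \<open>Slot \<open>m\<close> is now taken, so the other jobs start at
    \<open>Suc m\<close> at the earliest.\<close>
  define release' where "release' y = max (release y) (Suc m)" for y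
  have hall': "card {y \<in> X - {x}. a \<le> release' y \<and> deadline y \<le> b} \<le> b - a" for a b
  proof (cases "Suc m < a")
    case True
    then have "{y \<in> X - {x}. a \<le> release' y \<and> deadline y \<le> b} \<subseteq>
      {y \<in> X. a \<le> release y \<and> deadline y \<le> b}" by (auto simp: release'_def)
    then have "card {y \<in> X - {x}. a \<le> release' y \<and> deadline y \<le> b} \<le>
      card {y \<in> X. a \<le> release y \<and> deadline y \<le> b}" using fin by (intro card_mono) auto
    then show ?thesis using hall[of a b] by simp
  next
    case False
    \<comment> \<open>If \<open>deadline x \<le> b\<close>, dropping \<open>x\<close> from the count
      pays for the lost slot \<open>m\<close>. Otherwise no job of \<open>T\<close> is due by
      \<open>b\<close>, so the counted jobs were released after \<open>m\<close> anyway.\<close>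
    have "card {y \<in> X - {x}. a \<le> release' y \<and> deadline y \<le> b} \<le> b - Suc m"
    proof (cases "deadline x \<le> b")
      case True
      let ?S = "{y \<in> X. m \<le> release y \<and> deadline y \<le> b}"
      have "{y \<in> X - {x}. a \<le> release' y \<and> deadline y \<le> b} \<subseteq> ?S - {x}"
        using m_le by auto
      then have "card {y \<in> X - {x}. a \<le> release' y \<and> deadline y \<le> b} \<le> card (?S - {x})"
        using fin by (intro card_mono) auto
      also have "\<dots> = card ?S - 1"
        using xX rx True by (intro card_Diff_singleton) auto
      also have "\<dots> \<le> b - Suc m" using hall[of m b] by simp
      finally show ?thesis .
    next
      case False
      have "{y \<in> X - {x}. a \<le> release' y \<and> deadline y \<le> b} \<subseteq>
        {y \<in> X. Suc m \<le> release y \<and> deadline y \<le> b}"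
      proof safe
        fix y assume y: "y \<in> X" "deadline y \<le> b"
        then have "y \<notin> T" using False dx d_le by fastforce
        then show "Suc m \<le> release y" using m_le[of y] y by (simp add: T_def)
      qed
      then have "card {y \<in> X - {x}. a \<le> release' y \<and> deadline y \<le> b} \<le>
        card {y \<in> X. Suc m \<le> release y \<and> deadline y \<le> b}" using fin by (intro card_mono) auto
      then show ?thesis using hall[of "Suc m" b] by simp
    qed
    then show ?thesis using False by simp
  qed
  have "\<exists>f. inj_on f (X - {x}) \<and>
    (\<forall>y\<in>X - {x}. release' y \<le> f y \<and> f y < deadline y) \<and>
    (\<forall>u\<in>X - {x}. \<forall>v\<in>X - {x}. (u, v) \<in> R \<longrightarrow> f u < f v)"
  proof (rule Suc.hyps(1))
    show "c = card (X - {x})" using Suc.hyps(2) xX by simp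
    show "release' u \<le> release' v" if "u \<in> X - {x}" "v \<in> X - {x}" "(u, v) \<in> R" for u v
      unfolding release'_def using rel_mono[of u v] that by (intro max.mono) auto
  qed (use fin dl_mono hall' in auto)
  then obtain f where inj: "inj_on f (X - {x})"
    and win: "\<And>y. y \<in> X - {x} \<Longrightarrow> release' y \<le> f y \<and> f y < deadline y"
    and mono: "\<And>u v. u \<in> X - {x} \<Longrightarrow> v \<in> X - {x} \<Longrightarrow> (u, v) \<in> R \<Longrightarrow> f u < f v"
    by blast
  have later: "m < f y" if "y \<in> X - {x}" for y
    using win[OF that] by (simp add: release'_def)
  show ?case
  proof (intro exI conjI ballI impI)
    have "inj_on (f(x := m)) (insert x (X - {x}))"
      using inj later by (subst inj_on_insert) (fastforce simp: inj_on_def)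
    then show "inj_on (f(x := m)) X" using xX by (simp add: insert_absorb)
  next
    fix y assume "y \<in> X"
    then show "release y \<le> (f(x := m)) y" "(f(x := m)) y < deadline y"
      using win[of y] rx mdx by (auto simp: release'_def)
  next
    fix u v assume uv: "u \<in> X" "v \<in> X" "(u, v) \<in> R"
    then have "v \<noteq> x" using x_first by blast
    then show "(f(x := m)) u < (f(x := m)) v"
      using uv mono[of u v] later[of v] by auto
  qed
qed

section \<open>Necessity of the room conditions\<close>

text \<open>\<open>L\<close> maps the down-set of \<open>z\<close>, the up-set of \<open>z\<close>
  and the interval from \<open>z\<close> to \<open>w\<close> injectively into
  \<open>{1..L z}\<close>, \<open>{L z..card X}\<close> and \<open>{L z..L w}\<close>.\<close>

lemma linear_extension_bounds:
  assumes L: "L \<in> linear_extensions X r" and z: "z \<in> X" and w: "w \<in> X"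
  shows "b_low X r z \<le> L z" and "L z + b_up X r z \<le> card X + 1"
    and "(z, w) \<in> r \<Longrightarrow> b_between X r z w + L z \<le> L w + 1"
proof -
  have inj: "inj_on L X" and img: "L ` X = {1..card X}"
    and strict: "\<And>u v. u \<in> X \<Longrightarrow> v \<in> X \<Longrightarrow> prec r u v \<Longrightarrow> L u < L v"
    using L by (auto simp: linear_extensions_def bij_betw_def)
  have mono: "L u \<le> L v" if "u \<in> X" "v \<in> X" "(u, v) \<in> r" for u v
    using strict[of u v] that by (cases "u = v") (auto simp: prec_def)
  have range: "1 \<le> L u \<and> L u \<le> card X" if "u \<in> X" for u
    using img that by (metis atLeastAtMost_iff imageI)
  have fits: "card S \<le> Suc b - a" if "S \<subseteq> X" "L ` S \<subseteq> {a..b}" for S a b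
    using card_inj_on_le[OF inj_on_subset[OF inj that(1)] that(2)] by simp
  have "card {y \<in> X. (y, z) \<in> r} \<le> Suc (L z) - 1"
    using range mono z by (intro fits) auto
  then show "b_low X r z \<le> L z" by (simp add: b_low_def)
  have "card {y \<in> X. (z, y) \<in> r} \<le> Suc (card X) - L z"
    using range mono z by (intro fits) auto
  then show "L z + b_up X r z \<le> card X + 1" using range[OF z] unfolding b_up_def by linarith
  assume zw: "(z, w) \<in> r"
  have "card {y \<in> X. (z, y) \<in> r \<and> (y, w) \<in> r} \<le> Suc (L w) - L z"
    using mono z w by (intro fits) auto
  then show "b_between X r z w + L z \<le> L w + 1"
    using mono[OF z w zw] by (simp add: b_between_def)
qed

section \<open>Linear extensions with prescribed positions on a chain\<close>

text \<open>The room conditions of \<open>linear_extension_bounds\<close> supply Hall's condition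
  for the time windows that \<open>s\<close> forces on the elements of \<open>X\<close>, so on a
  chain they are also sufficient.\<close>

theorem linear_extension_through_chain:
  fixes s :: "'a \<Rightarrow> nat"
  assumes po: "partial_order_on X r" and fin: "finite X" and ZX: "Z \<subseteq> X"
    and chain: "\<And>z w. z \<in> Z \<Longrightarrow> w \<in> Z \<Longrightarrow> (z, w) \<in> r \<or> (w, z) \<in> r"
    and low: "\<And>z. z \<in> Z \<Longrightarrow> b_low X r z \<le> s z"
    and up: "\<And>z. z \<in> Z \<Longrightarrow> s z + b_up X r z \<le> card X + 1"
    and between: "\<And>z w. z \<in> Z \<Longrightarrow> w \<in> Z \<Longrightarrow> (z, w) \<in> r \<Longrightarrow>
      b_between X r z w + s z \<le> s w + 1"
  shows "\<exists>L \<in> linear_extensions X r. \<forall>z\<in>Z. L z = s z"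
proof -
  have refl: "\<And>x. x \<in> X \<Longrightarrow> (x, x) \<in> r" and trans: "trans r" and anti: "antisym r"
    using po by (auto simp: partial_order_on_def preorder_on_def refl_on_def)
  have rX: "r \<subseteq> X \<times> X" using po by (auto simp: partial_order_on_def preorder_on_def refl_on_def)
  have finZ: "finite Z" using finite_subset[OF ZX fin] .
  have s_strict: "s z < s w" if "z \<in> Z" "w \<in> Z" "(z, w) \<in> r" "z \<noteq> w" for z w
  proof -
    \<comment> \<open>The interval contains both \<open>z\<close> and \<open>w\<close>, so
      \<open>between\<close> forces a gap of at least one.\<close>
    have "card {z, w} \<le> b_between X r z w"
      unfolding b_between_def using that ZX refl fin by (intro card_mono) auto
    then show ?thesis using between[OF that(1-3)] that(4) by simp
  qed
  have s_le: "(z, w) \<in> r" if "z \<in> Z" "w \<in> Z" "s z \<le> s w" for z w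
    using s_strict[of w z] chain[of z w] that refl ZX by (cases "z = w") auto
  \<comment> \<open>The inserted \<open>1\<close> and \<open>card X + 1\<close> keep all slots in
    \<open>{1..card X}\<close>; \<open>Suc\<close> is there because deadlines are exclusive.\<close>
  define release where "release x = Max (insert 1 (s ` {z \<in> Z. (z, x) \<in> r}))" for x
  define deadline where
    "deadline x = Min (insert (card X + 1) ((\<lambda>z. Suc (s z)) ` {z \<in> Z. (x, z) \<in> r}))" for x
  have release_ge: "a \<le> release x \<longleftrightarrow> a \<le> 1 \<or> (\<exists>z\<in>Z. (z, x) \<in> r \<and> a \<le> s z)" for a x
    unfolding release_def using finZ by (subst Max_ge_iff) auto
  have deadline_le: "deadline x \<le> b \<longleftrightarrow>
      card X + 1 \<le> b \<or> (\<exists>z\<in>Z. (x, z) \<in> r \<and> Suc (s z) \<le> b)" for b x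
    unfolding deadline_def using finZ by (subst Min_le_iff) auto
  have hall: "card {x \<in> X. a \<le> release x \<and> deadline x \<le> b} \<le> b - a" (is "card ?S \<le> _") for a b
  proof (cases "?S = {}")
    case True
    show ?thesis unfolding True by simp
  next
    case False
    \<comment> \<open>Beyond the default, each job in \<open>?S\<close> lies above some chain
      element placed at \<open>a\<close> or later. The lowest such element lies below the others,
      hence below all of \<open>?S\<close>. Deadlines are treated dually.\<close>
    consider "a \<le> 1" | z where "z \<in> Z" "a \<le> s z" "\<And>x. x \<in> ?S \<Longrightarrow> (z, x) \<in> r"
    proof (cases "a \<le> 1")
      case False
      then obtain z' where "z' \<in> Z" "a \<le> s z'" using \<open>?S \<noteq> {}\<close> unfolding release_ge by blast
      then obtain z where z: "z \<in> Z" "a \<le> s z" and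
        least: "\<And>w. w \<in> Z \<Longrightarrow> a \<le> s w \<Longrightarrow> s z \<le> s w"
        using arg_min_nat_lemma[of "\<lambda>z. z \<in> Z \<and> a \<le> s z" z' s] by blast
      have "(z, x) \<in> r" if x: "x \<in> ?S" for x
      proof -
        obtain w where "w \<in> Z" "(w, x) \<in> r" "a \<le> s w"
          using x False unfolding release_ge by blast
        then show ?thesis using s_le[OF z(1) _ least] transD[OF trans] by blast
      qed
      with z that show thesis by blast
    qed
    note lower = this
    consider "card X + 1 \<le> b" | z where "z \<in> Z" "Suc (s z) \<le> b" "\<And>x. x \<in> ?S \<Longrightarrow> (x, z) \<in> r"
    proof (cases "card X + 1 \<le> b")
      case False
      then obtain z' where z': "z' \<in> Z" "Suc (s z') \<le> b" using \<open>?S \<noteq> {}\<close> unfolding deadline_le by blast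
      obtain z where z: "z \<in> Z" "Suc (s z) \<le> b" and
        greatest: "\<And>w. w \<in> Z \<Longrightarrow> Suc (s w) \<le> b \<Longrightarrow> s w \<le> s z"
        using arg_max_nat_lemma[of "\<lambda>z. z \<in> Z \<and> Suc (s z) \<le> b" z' s b] z' by auto
      have "(x, z) \<in> r" if x: "x \<in> ?S" for x
      proof -
        obtain w where "w \<in> Z" "(x, w) \<in> r" "Suc (s w) \<le> b"
          using x False unfolding deadline_le by blast
        then show ?thesis using s_le[OF _ z(1) greatest] transD[OF trans] by blast
      qed
      with z that show thesis by blast
    qed
    note upper = this
    \<comment> \<open>The jobs lie in all of \<open>X\<close>, a down-set, an up-set or an interval,
      and the matching room condition bounds their number. In the interval case, a job from the
      nonempty \<open>?S\<close> yields \<open>(z, w) \<in> r\<close>.\<close>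
    show ?thesis
    proof (cases rule: lower)
      case 1
      note a = 1
      show ?thesis
      proof (cases rule: upper)
        case 1
        have "card ?S \<le> card X" using fin by (intro card_mono) auto
        then show ?thesis using a 1 by simp
      next
        case (2 w)
        have "card ?S \<le> b_low X r w"
          unfolding b_low_def using fin 2(3) by (intro card_mono) auto
        then show ?thesis using a 2(2) low[OF 2(1)] by simp
      qed
    next
      case (2 z)
      note z = 2
      show ?thesis
      proof (cases rule: upper)
        case 1
        have "card ?S \<le> b_up X r z"
          unfolding b_up_def using fin z(3) by (intro card_mono) auto
        then show ?thesis using z(2) up[OF z(1)] 1 by simp
      next
        case (2 w)
        have "card ?S \<le> b_between X r z w"
          unfolding b_between_def using fin z(3) 2(3) by (intro card_mono) auto
        moreover have "(z, w) \<in> r" using False z(3) 2(3) transD[OF trans] by blast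
        ultimately show ?thesis using z(2) 2(2) between[OF z(1) 2(1)] by simp
      qed
    qed
  qed
  have "wf (r - Id)"
  proof (rule finite_acyclic_wf)
    show "finite (r - Id)" using rX fin by (meson finite_Diff finite_SigmaI finite_subset)
    have "trans (r - Id)" using trans anti by (rule trans_diff_Id)
    then show "acyclic (r - Id)" by (auto simp: acyclic_def)
  qed
  then have "\<exists>f. inj_on f X \<and> (\<forall>x\<in>X. release x \<le> f x \<and> f x < deadline x) \<and>
    (\<forall>u\<in>X. \<forall>v\<in>X. (u, v) \<in> r - Id \<longrightarrow> f u < f v)"
  proof (rule schedule_exists[OF fin])
    fix u v assume uv: "(u, v) \<in> r - Id"
    \<comment> \<open>Unfolded by \<open>release_ge\<close> and \<open>deadline_le\<close>, these
      trivial facts name a chain element attaining each extreme, or the default; transitivity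
      carries it across the pair \<open>(u, v)\<close>.\<close>
    have "release u \<le> release u" "deadline v \<le> deadline v" by simp_all
    then show "release u \<le> release v" "deadline u \<le> deadline v"
      using uv transD[OF trans] unfolding release_ge deadline_le by blast+
  qed (rule hall)
  then obtain f where inj: "inj_on f X"
    and win: "\<And>x. x \<in> X \<Longrightarrow> release x \<le> f x \<and> f x < deadline x"
    and strict: "\<And>u v. u \<in> X \<Longrightarrow> v \<in> X \<Longrightarrow> (u, v) \<in> r - Id \<Longrightarrow> f u < f v"
    by blast
  have "f ` X \<subseteq> {1..card X}"
  proof safe
    fix x assume "x \<in> X"
    moreover have "1 \<le> release x" "deadline x \<le> card X + 1"
      unfolding release_ge deadline_le by simp_all
    ultimately show "f x \<in> {1..card X}" using win[of x] by simp
  qed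
  then have "f ` X = {1..card X}"
    using card_image[OF inj] by (intro card_subset_eq) auto
  with inj have "bij_betw (restrict f X) X {1..card X}"
    by (simp add: bij_betw_def inj_on_restrict_eq)
  then have "restrict f X \<in> linear_extensions X r"
    using strict by (auto simp: linear_extensions_def prec_def)
  moreover have "restrict f X z = s z" if "z \<in> Z" for z
  proof -
    have zX: "z \<in> X" using that ZX by blast
    have "s z \<le> release z" "deadline z \<le> Suc (s z)"
      unfolding release_ge deadline_le using that refl[OF zX] by auto
    then show ?thesis using win[OF zX] zX by simp
  qed
  ultimately show ?thesis by blast
qed

section \<open>The chain of three elements\<close>

text \<open>An infinite set has \<open>card\<close> equal to 0, so finiteness is what turns the
  existence of some \<open>L\<close> into \<open>F_count > 0\<close>.\<close>

lemma finite_linear_extensions: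
  assumes "finite X"
  shows "finite (linear_extensions X r)"
proof (rule finite_subset)
  show "linear_extensions X r \<subseteq> X \<rightarrow>\<^sub>E {1..card X}"
    by (auto simp: linear_extensions_def PiE_def bij_betw_def)
  show "finite (X \<rightarrow>\<^sub>E {1..card X})" using assms by (simp add: finite_PiE)
qed

text \<open>Inclusion-exclusion. It turns the lower bounds on \<open>k\<close>, \<open>l\<close> and
  \<open>k + l\<close> into compatibility of lower and upper limits on the position of
  \<open>z1\<close>.\<close>

lemma b_low_plus_b_up_le:
  assumes "finite X"
  shows "b_low X r w + b_up X r z \<le> card X + b_between X r z w"
proof -
  let ?D = "{y \<in> X. (y, w) \<in> r}" and ?U = "{y \<in> X. (z, y) \<in> r}"
  have "card ?D + card ?U = card (?D \<union> ?U) + card (?D \<inter> ?U)"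
    using assms by (intro card_Un_Int) auto
  moreover have "card (?D \<union> ?U) \<le> card X" using assms by (intro card_mono) auto
  moreover have "?D \<inter> ?U = {y \<in> X. (z, y) \<in> r \<and> (y, w) \<in> r}" by auto
  ultimately show ?thesis by (simp add: b_low_def b_up_def b_between_def)
qed

theorem theorem4p2:
  fixes X :: "'a set" and r :: "'a rel" and n :: nat
    and z1 z2 z3 :: 'a and k l :: int
  assumes "partial_order_on X r" and "finite X" and "card X = n"
    and "z1 \<in> X" and "z2 \<in> X" and "z3 \<in> X"
    and "distinct [z1, z2, z3]"
    and "prec r z1 z2" and "prec r z2 z3"
    and "k \<ge> 1" and "l \<ge> 1"
  shows "F_count X r z1 z2 z3 k l > 0 \<longleftrightarrow>
      (int (b_between X r z1 z2) - 1 \<le> k \<and>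
       k \<le> int n + 1 - int (b_low X r z1) - int (b_up X r z2)) \<and>
      (int (b_between X r z2 z3) - 1 \<le> l \<and>
       l \<le> int n + 1 - int (b_up X r z3) - int (b_low X r z2)) \<and>
      (int (b_between X r z1 z3) - 1 \<le> k + l \<and>
       k + l \<le> int n + 1 - int (b_up X r z3) - int (b_low X r z1))"
proof -
  have refl: "\<And>x. x \<in> X \<Longrightarrow> (x, x) \<in> r" and trans: "trans r" and anti: "antisym r"
    using assms(1) by (auto simp: partial_order_on_def preorder_on_def refl_on_def)
  have r12: "(z1, z2) \<in> r" and r23: "(z2, z3) \<in> r"
    using assms(8,9) by (auto simp: prec_def)
  have r13: "(z1, z3) \<in> r" using transD[OF trans r12 r23] .
  have ne: "z1 \<noteq> z2" "z1 \<noteq> z3" "z2 \<noteq> z3" using assms(7) by auto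
  have nr: "(z2, z1) \<notin> r" "(z3, z2) \<notin> r" "(z3, z1) \<notin> r"
    using r12 r23 r13 ne antisymD[OF anti] by blast+
  have F_pos: "F_count X r z1 z2 z3 k l > 0 \<longleftrightarrow>
      (\<exists>L\<in>linear_extensions X r. int (L z2) - int (L z1) = k \<and> int (L z3) - int (L z2) = l)"
    unfolding F_count_def using finite_linear_extensions[OF assms(2), of r]
    by (auto simp: card_gt_0_iff)
  show ?thesis (is "_ \<longleftrightarrow> ?bounds")
  proof
    assume "F_count X r z1 z2 z3 k l > 0"
    then obtain L where L: "L \<in> linear_extensions X r"
      and kl: "int (L z2) - int (L z1) = k" "int (L z3) - int (L z2) = l"
      using F_pos by blast
    note bounds = linear_extension_bounds[OF L]
    show ?bounds
      using kl assms(3) bounds(1,2)[OF assms(4,4)] bounds(1,2)[OF assms(5,5)]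
        bounds(1,2)[OF assms(6,6)] bounds(3)[OF assms(4,5) r12] bounds(3)[OF assms(5,6) r23]
        bounds(3)[OF assms(4,6) r13]
      by linarith
  next
    assume B: ?bounds
    \<comment> \<open>The least position of \<open>z1\<close> that leaves room below all three
      elements when \<open>z2\<close> and \<open>z3\<close> follow at distances \<open>k\<close> and
      \<open>l\<close>.\<close>
    define p where "p = max (int (b_low X r z1))
      (max (int (b_low X r z2) - k) (int (b_low X r z3) - k - l))"
    have p_low: "int (b_low X r z1) \<le> p" "int (b_low X r z2) \<le> p + k"
        "int (b_low X r z3) \<le> p + k + l"
      unfolding p_def by linarith+
    have low_up: "int (b_low X r w) + int (b_up X r z) \<le> int n + int (b_between X r z w)" for z w
      using b_low_plus_b_up_le[OF assms(2), of r w z] assms(3) by linarith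
    have single: "b_between X r z z = 1" if "z \<in> X" for z
    proof -
      have "{w \<in> X. (z, w) \<in> r \<and> (w, z) \<in> r} = {z}"
        using that refl antisymD[OF anti] by blast
      then show ?thesis by (simp add: b_between_def)
    qed
    \<comment> \<open>Each lower limit in \<open>p\<close> meets each upper limit. For limits from
      the same element use \<open>single\<close>; if the lower limit comes from the higher element,
      \<open>low_up\<close> and a lower bound in \<open>B\<close>; otherwise an upper bound in
      \<open>B\<close>.\<close>
    have p_up: "p + int (b_up X r z1) \<le> int n + 1" "p + k + int (b_up X r z2) \<le> int n + 1"
        "p + k + l + int (b_up X r z3) \<le> int n + 1"
      using B low_up[of z1 z1] low_up[of z2 z1] low_up[of z3 z1] low_up[of z2 z2]
        low_up[of z3 z2] low_up[of z3 z3] single[OF assms(4)] single[OF assms(5)]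
        single[OF assms(6)]
      unfolding p_def by linarith+
    \<comment> \<open>\<open>nat\<close> loses nothing: by \<open>p_low\<close> all three values are
      nonnegative.\<close>
    define s where "s x = nat (if x = z1 then p else if x = z2 then p + k else p + k + l)" for x
    have s: "int (s z1) = p" "int (s z2) = p + k" "int (s z3) = p + k + l"
      using p_low assms(10,11) ne by (auto simp: s_def)
    have "\<exists>L\<in>linear_extensions X r. \<forall>z\<in>{z1, z2, z3}. L z = s z"
    proof (rule linear_extension_through_chain[OF assms(1,2)])
      show "{z1, z2, z3} \<subseteq> X" using assms(4-6) by simp
      show "(z, w) \<in> r \<or> (w, z) \<in> r" if "z \<in> {z1, z2, z3}" "w \<in> {z1, z2, z3}" for z w
        using that r12 r23 r13 refl assms(4-6) by auto
      show "b_low X r z \<le> s z" if "z \<in> {z1, z2, z3}" for z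
        using that p_low s by auto
      show "s z + b_up X r z \<le> card X + 1" if "z \<in> {z1, z2, z3}" for z
        using that p_up s assms(3) by auto
      have "b_between X r z1 z2 + s z1 \<le> s z2 + 1" "b_between X r z2 z3 + s z2 \<le> s z3 + 1"
          "b_between X r z1 z3 + s z1 \<le> s z3 + 1"
        using B s by linarith+
      then show "b_between X r z w + s z \<le> s w + 1"
        if "z \<in> {z1, z2, z3}" "w \<in> {z1, z2, z3}" "(z, w) \<in> r" for z w
        using that nr single assms(4-6) by auto
    qed
    then obtain L where "L \<in> linear_extensions X r" "L z1 = s z1" "L z2 = s z2" "L z3 = s z3"
      by auto
    then show "F_count X r z1 z2 z3 k l > 0" using F_pos s by fastforce
  qed
qed

end
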